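(* Let $\lambda$ be a monadic stream GSOS specification over a signature $\Sigma$ and output set $A$, with term functor $T$ and induced distributive law $\rho:T(A\times-)\Rightarrow A\times T(-)$, and let $\mathcal V$ be a set of variables. Let $\kappa:T\Rightarrow C$ be the unique morphism in $\mathrm{DL}(F)$ from $(T,\rho)$ to the companion $(C,\gamma)$ of $FX=A\times X$ described below. Then $\kappa_{\mathcal V}=[\![-]\!]_o$, i.e., $\kappa_{\mathcal V}(t)(\psi)=[\![t]\!]_o(\psi)$ for all $t\in T\mathcal V$, $\psi:\mathcal V\to A^\omega$.
   Context: $TX$ is the set of $\Sigma$-terms over $X$. A monadic stream GSOS specification for $\Sigma$ and $A$ is a set of rules $\frac{x_1\xrightarrow{a_1}x_1'\cdots x_n\xrightarrow{a_n}x_n'}{f(x_1,\dots,x_n)\xrightarrow{a}t}$ ($f$ of arity $n$, pairwise distinct variables, $t$ a $\Sigma$-term over $\{x_1',\dots,x_n'\}$ only) such that for each $f$ and each $(a_1,\dots,a_n)\in A^n$ exactly one rule for $f$ has premise labels $(a_1,\dots,a_n)$. The induced $\rho_X:T(A\times X)\to A\times TX$: leaf $(a,x)\mapsto(a,x)$; $f(u_1,\dots,u_n)\mapsto(a,t[s_1/x_1',\dots,s_n/x_n'])$ where $\rho_X(u_i)=(a_i,s_i)$ and the rule for $f$ with premise labels $(a_1,\dots,a_n)$ has conclusion $f(\vec x)\xrightarrow{a}t$. $\mathrm{DL}(F)$: objects are pairs $(H,\delta)$ of an endofunctor $H$ on Set and natural $\delta:HF\Rightarrow FH$; morphisms $(H_1,\delta_1)\to(H_2,\delta_2)$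 are natural $\theta:H_1\Rightarrow H_2$ with $\delta_2\circ\theta F=F\theta\circ\delta_1$. The companion is a final object $(C,\gamma)$ of $\mathrm{DL}(F)$; it is given by: $CX$ is the set of causal functions $\mathfrak c:(A^\omega)^X\to A^\omega$ (for all $n$, if $\psi(x)\restriction_n=\psi'(x)\restriction_n$ for all $x$ then $\mathfrak c(\psi)\restriction_n=\mathfrak c(\psi')\restriction_n$), $C(h)(\mathfrak c)(\varphi)=\mathfrak c(\varphi\circ h)$, and $\gamma_X(\mathfrak c)=(\mathrm{hd}(\mathfrak c((a,x)\mapsto a.\alpha)),\mathfrak c')$ with $\alpha$ arbitrary and $\mathfrak c'(\psi)=\mathrm{tl}(\mathfrak c((a,x)\mapsto a.\psi(x)))$, where $a.\alpha$ prepends $a$. Open semantics: the Mealy machine on $T\mathcal V$ with inputs $\varsigma:\mathcal V\to A$ has $\mathcal X\xrightarrow{\varsigma\mid\varsigma(\mathcal X)}\mathcal X$ for variables and $f(t_1,\dots,t_n)\xrightarrow{\varsigma\mid a}t[t_1'/x_1',\dots,t_n'/x_n']$ whenever $t_i\xrightarrow{\varsigma\mid a_i}t_i'$ and the rule for $f$ with premise labels $(a_1,\dots,a_n)$ has conclusion $f(\vec x)\xrightarrow{a}t$. Then $[\![t]\!]_o(\psi)=a_0a_1a_2\cdots$ where $t_0=t$, $t_k\xrightarrow{\varsigma_k\mid a_k}t_{k+1}$ and $\varsigma_k(\mathcal X)=\psi(\mathcal X)(k)$. *)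

theory Defs
  imports "HOL-Library.FuncSet" "HOL-Library.Stream"
begin

section \<open>Terms over a signature\<close>

text \<open>A signature is a type \<open>'f\<close> of operation symbols with an arity function \<open>ar\<close>.  The datatype
  below also contains ill-formed applications; the set of terms over \<open>X\<close> is \<open>terms ar X\<close>.\<close>

datatype (dead 'f, vars: 'x) trm = Var 'x | Op 'f "('f, 'x) trm list"
  for map: map_trm

inductive_set terms :: "('f \<Rightarrow> nat) \<Rightarrow> 'x set \<Rightarrow> ('f, 'x) trm set"
  for ar :: "'f \<Rightarrow> nat" and X :: "'x set" where
  var: "x \<in> X \<Longrightarrow> Var x \<in> terms ar X"
| oper: "length ts = ar f \<Longrightarrow> \<forall>t\<in>set ts. t \<in> terms ar X \<Longrightarrow> Op f ts \<in> terms ar X"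

primrec subst :: "('y \<Rightarrow> ('f, 'x) trm) \<Rightarrow> ('f, 'y) trm \<Rightarrow> ('f, 'x) trm" where
  "subst \<sigma> (Var y) = \<sigma> y"
| "subst \<sigma> (Op f ts) = Op f (map (subst \<sigma>) ts)"


section \<open>Monadic stream GSOS specifications\<close>

text \<open>\<open>Rule f [x1,...,xn] [a1,...,an] [x1',...,xn'] a t\<close> is the rule with premises
  \<open>xi --ai--> xi'\<close> and conclusion \<open>f(x1,...,xn) --a--> t\<close>.\<close>

datatype ('f, 'a, 'y) rule =
  Rule (rop: 'f) (sources: "'y list") (labels: "'a list") (targets: "'y list")
    (out: 'a) (body: "('f, 'y) trm")

definition wf_rule :: "('f \<Rightarrow> nat) \<Rightarrow> ('f, 'a, 'y) rule \<Rightarrow> bool" where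
  "wf_rule ar r \<longleftrightarrow>
     length (sources r) = ar (rop r) \<and>
     length (labels r) = ar (rop r) \<and>
     length (targets r) = ar (rop r) \<and>
     distinct (sources r @ targets r) \<and>
     body r \<in> terms ar (set (targets r))"

definition monadic_gsos :: "('f \<Rightarrow> nat) \<Rightarrow> ('f, 'a, 'y) rule set \<Rightarrow> bool" where
  "monadic_gsos ar R \<longleftrightarrow>
     (\<forall>r\<in>R. wf_rule ar r) \<and>
     (\<forall>f as. length as = ar f \<longrightarrow> (\<exists>!r. r \<in> R \<and> rop r = f \<and> labels r = as))"

definition the_rule :: "('f, 'a, 'y) rule set \<Rightarrow> 'f \<Rightarrow> 'a list \<Rightarrow> ('f, 'a, 'y) rule" where
  "the_rule R f as = (THE r. r \<in> R \<and> rop r = f \<and> labels r = as)"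

text \<open>\<open>inst r [s1,...,sn]\<close> is \<open>t[s1/x1',...,sn/xn']\<close> for the target term \<open>t\<close> of the rule \<open>r\<close>.\<close>

definition inst :: "('f, 'a, 'y) rule \<Rightarrow> ('f, 'x) trm list \<Rightarrow> ('f, 'x) trm" where
  "inst r ss = subst (\<lambda>y. the (map_of (zip (targets r) ss) y)) (body r)"

primrec rho :: "('f, 'a, 'y) rule set \<Rightarrow> ('f, 'a \<times> 'x) trm \<Rightarrow> 'a \<times> ('f, 'x) trm" where
  "rho R (Var p) = (fst p, Var (snd p))"
| "rho R (Op f us) =
     (let ps = map (rho R) us; r = the_rule R f (map fst ps)
      in (out r, inst r (map snd ps)))"


section \<open>Open semantics\<close>

text \<open>\<open>step R \<sigma> t a t'\<close> is the Mealy transition from \<open>t\<close> to \<open>t'\<close> with input \<open>\<sigma>\<close> and output \<open>a\<close>.\<close>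

inductive step ::
  "('f, 'a, 'y) rule set \<Rightarrow> ('x \<Rightarrow> 'a) \<Rightarrow> ('f, 'x) trm \<Rightarrow> 'a \<Rightarrow> ('f, 'x) trm \<Rightarrow> bool"
  for R :: "('f, 'a, 'y) rule set" and \<sigma> :: "'x \<Rightarrow> 'a" where
  var: "step R \<sigma> (Var x) (\<sigma> x) (Var x)"
| oper: "r \<in> R \<Longrightarrow> length (labels r) = length ts \<Longrightarrow> length ts' = length ts \<Longrightarrow>
    \<forall>i<length ts. step R \<sigma> (ts ! i) (labels r ! i) (ts' ! i) \<Longrightarrow>
    step R \<sigma> (Op (rop r) ts) (out r) (inst r ts')"

definition open_run ::
  "('f, 'a, 'y) rule set \<Rightarrow> ('f, 'x) trm \<Rightarrow> ('x \<Rightarrow> 'a stream) \<Rightarrow> 'a stream \<Rightarrow> bool" where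
  "open_run R t \<psi> s \<longleftrightarrow>
     (\<exists>ts. ts 0 = t \<and> (\<forall>k. step R (\<lambda>x. \<psi> x !! k) (ts k) (s !! k) (ts (Suc k))))"

definition open_sem ::
  "('f, 'a, 'y) rule set \<Rightarrow> ('f, 'x) trm \<Rightarrow> ('x \<Rightarrow> 'a stream) \<Rightarrow> 'a stream" where
  "open_sem R t \<psi> = (THE s. open_run R t \<psi> s)"


section \<open>The category of distributive laws over \<open>F X = A \<times> X\<close>\<close>

text \<open>Since HOL cannot quantify over families indexed by all types, \<open>Set\<close> is rendered as a
  class \<open>U\<close> of subsets of an arbitrary type \<open>'u\<close> that is closed under \<open>F\<close>.  The output set is the
  type \<open>'a\<close>, and an arbitrary injection \<open>pair\<close> provides the ordered pairs of which
  \<open>F X \<subseteq> 'u\<close> consists.  A map from \<open>X\<close> to \<open>Y\<close> is represented by any \<open>h \<in> X \<rightarrow> Y\<close>; two such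
  functions denote the same map iff they agree on \<open>X\<close>.\<close>

definition F_obj :: "('a \<times> 'u \<Rightarrow> 'u) \<Rightarrow> 'u set \<Rightarrow> 'u set" where
  "F_obj pair X = pair ` (UNIV \<times> X)"

definition F_arr :: "('a \<times> 'u \<Rightarrow> 'u) \<Rightarrow> ('u \<Rightarrow> 'u) \<Rightarrow> 'u \<Rightarrow> 'u" where
  "F_arr pair h = pair \<circ> map_prod id h \<circ> inv pair"

definition set_universe :: "'u set set \<Rightarrow> ('a \<times> 'u \<Rightarrow> 'u) \<Rightarrow> bool" where
  "set_universe U pair \<longleftrightarrow> inj pair \<and> (\<forall>X\<in>U. F_obj pair X \<in> U)"

text \<open>Every type \<open>'v\<close> occurs inside some universe.\<close>

lemma set_universe_exists:
  "set_universe UNIV (\<lambda>(a :: 'a, w, v :: 'v). (a # w, v))"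
  by (auto simp: set_universe_def inj_def)

text \<open>The values of a functor may live in a type \<open>'h\<close> other than \<open>'u\<close>; on values, \<open>F\<close> is the
  ordinary product with the type \<open>'a\<close>.\<close>

datatype ('u, 'h) set_functor =
  Set_Functor (obj: "'u set \<Rightarrow> 'h set")
    (arr: "'u set \<Rightarrow> 'u set \<Rightarrow> ('u \<Rightarrow> 'u) \<Rightarrow> 'h \<Rightarrow> 'h")

definition is_functor :: "'u set set \<Rightarrow> ('u, 'h) set_functor \<Rightarrow> bool" where
  "is_functor U H \<longleftrightarrow>
     (\<forall>X\<in>U. \<forall>Y\<in>U. \<forall>h \<in> X \<rightarrow> Y. arr H X Y h \<in> obj H X \<rightarrow> obj H Y) \<and>
     (\<forall>X\<in>U. \<forall>Y\<in>U. \<forall>h \<in> X \<rightarrow> Y. \<forall>h' \<in> X \<rightarrow> Y. (\<forall>x\<in>X. h x = h' x) \<longrightarrow>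
        (\<forall>z\<in>obj H X. arr H X Y h z = arr H X Y h' z)) \<and>
     (\<forall>X\<in>U. \<forall>z\<in>obj H X. arr H X X id z = z) \<and>
     (\<forall>X\<in>U. \<forall>Y\<in>U. \<forall>Z\<in>U. \<forall>h \<in> X \<rightarrow> Y. \<forall>g \<in> Y \<rightarrow> Z. \<forall>z\<in>obj H X.
        arr H X Z (g \<circ> h) z = arr H Y Z g (arr H X Y h z))"

definition nat_trans ::
  "'u set set \<Rightarrow> ('u, 'h) set_functor \<Rightarrow> ('u, 'k) set_functor \<Rightarrow> ('u set \<Rightarrow> 'h \<Rightarrow> 'k) \<Rightarrow> bool" where
  "nat_trans U H K \<theta> \<longleftrightarrow>
     \<theta> \<in> (\<Pi>\<^sub>E X\<in>U. obj H X \<rightarrow>\<^sub>E obj K X) \<and>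
     (\<forall>X\<in>U. \<forall>Y\<in>U. \<forall>h \<in> X \<rightarrow> Y. \<forall>z\<in>obj H X.
        arr K X Y h (\<theta> X z) = \<theta> Y (arr H X Y h z))"

definition after_F :: "('a \<times> 'u \<Rightarrow> 'u) \<Rightarrow> ('u, 'h) set_functor \<Rightarrow> ('u, 'h) set_functor" where
  \<comment> \<open>the composite \<open>H F\<close>\<close>
  "after_F pair H =
     Set_Functor (\<lambda>X. obj H (F_obj pair X))
       (\<lambda>X Y h. arr H (F_obj pair X) (F_obj pair Y) (F_arr pair h))"

definition then_F :: "('u, 'h) set_functor \<Rightarrow> ('u, 'a \<times> 'h) set_functor" where
  \<comment> \<open>the composite \<open>F H\<close>\<close>
  "then_F H = Set_Functor (\<lambda>X. UNIV \<times> obj H X) (\<lambda>X Y h. map_prod id (arr H X Y h))"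

type_synonym ('a, 'u, 'h) dist_law = "('u, 'h) set_functor \<times> ('u set \<Rightarrow> 'h \<Rightarrow> 'a \<times> 'h)"

definition dl_object :: "'u set set \<Rightarrow> ('a \<times> 'u \<Rightarrow> 'u) \<Rightarrow> ('a, 'u, 'h) dist_law \<Rightarrow> bool" where
  "dl_object U pair D \<longleftrightarrow>
     is_functor U (fst D) \<and> nat_trans U (after_F pair (fst D)) (then_F (fst D)) (snd D)"

definition dl_morphism ::
  "'u set set \<Rightarrow> ('a \<times> 'u \<Rightarrow> 'u) \<Rightarrow> ('a, 'u, 'h) dist_law \<Rightarrow> ('a, 'u, 'k) dist_law \<Rightarrow>
   ('u set \<Rightarrow> 'h \<Rightarrow> 'k) \<Rightarrow> bool" where
  "dl_morphism U pair D1 D2 \<theta> \<longleftrightarrow>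
     dl_object U pair D1 \<and> dl_object U pair D2 \<and> nat_trans U (fst D1) (fst D2) \<theta> \<and>
     (\<forall>X\<in>U. \<forall>z\<in>obj (fst D1) (F_obj pair X).
        snd D2 X (\<theta> (F_obj pair X) z) = map_prod id (\<theta> X) (snd D1 X z))"


section \<open>The term functor and the companion\<close>

definition term_functor :: "('f \<Rightarrow> nat) \<Rightarrow> ('u, ('f, 'u) trm) set_functor" where
  "term_functor ar = Set_Functor (terms ar) (\<lambda>X Y h. map_trm h)"

definition term_law ::
  "'u set set \<Rightarrow> ('a \<times> 'u \<Rightarrow> 'u) \<Rightarrow> ('f \<Rightarrow> nat) \<Rightarrow> ('f, 'a, 'y) rule set \<Rightarrow>
   ('a, 'u, ('f, 'u) trm) dist_law" where
  "term_law U pair ar R =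
     (term_functor ar,
      \<lambda>X\<in>U. \<lambda>u\<in>terms ar (F_obj pair X). rho R (map_trm (inv pair) u))"

text \<open>Functions from \<open>X\<close> to streams are represented by total functions on \<open>'u\<close>.  By the causality
  condition for all \<open>n\<close>, the value of a causal \<open>c\<close> at \<open>\<psi>\<close> depends only on \<open>\<psi>\<close> restricted to \<open>X\<close>,
  so the set below is in bijection with the causal functions on the restrictions.\<close>

definition causal :: "'u set \<Rightarrow> (('u \<Rightarrow> 'a stream) \<Rightarrow> 'a stream) set" where
  "causal X = {c. \<forall>n \<psi> \<psi>'. (\<forall>x\<in>X. stake n (\<psi> x) = stake n (\<psi>' x)) \<longrightarrow>
                    stake n (c \<psi>) = stake n (c \<psi>')}"

definition companion_functor :: "('u, ('u \<Rightarrow> 'a stream) \<Rightarrow> 'a stream) set_functor" where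
  "companion_functor = Set_Functor causal (\<lambda>X Y h c \<phi>. c (\<phi> \<circ> h))"

text \<open>\<open>\<alpha>\<close> is the arbitrary stream used in the definition of the output.\<close>

definition companion ::
  "'u set set \<Rightarrow> ('a \<times> 'u \<Rightarrow> 'u) \<Rightarrow> 'a stream \<Rightarrow>
   ('a, 'u, ('u \<Rightarrow> 'a stream) \<Rightarrow> 'a stream) dist_law" where
  "companion U pair \<alpha> =
     (companion_functor,
      \<lambda>X\<in>U. \<lambda>c\<in>causal (F_obj pair X).
        (shd (c (\<lambda>p. case inv pair p of (a, x) \<Rightarrow> a ## \<alpha>)),
         \<lambda>\<psi>. stl (c (\<lambda>p. case inv pair p of (a, x) \<Rightarrow> a ## \<psi> x))))"

end

theory Submission
  imports Defs
begin

text \<open>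
  Feeding the input \<open>\<sigma>\<close> into the leaves of a term and applying \<open>\<rho>\<close> gives the Mealy machine of the
  open semantics, so the open semantics is the final coalgebra map of \<open>t \<mapsto> \<rho> (T\<langle>\<sigma>, id\<rangle> t)\<close>, and
  naturality of \<open>\<rho>\<close> makes it a morphism of distributive laws into the companion.  Conversely, let
  \<open>\<kappa>\<close> be any such morphism, and factor \<open>\<psi> : V \<rightarrow> A\<^sup>\<omega>\<close> through
  \<open>h = \<langle>hd \<circ> \<psi>, id\<rangle> : V \<rightarrow> A \<times> V\<close>.  Naturality of \<open>\<kappa>\<close> along \<open>h\<close> followed by the morphism
  equation shows that \<open>\<kappa>\<close> unfolds in the same way as the open semantics, and coinduction yields
  equality.
\<close>

section \<open>Terms, renaming and rule instantiation\<close>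

lemma map_trm_terms:
  assumes "t \<in> terms ar X" "h \<in> X \<rightarrow> Y"
  shows "map_trm h t \<in> terms ar Y"
  using assms by (induction t) (auto intro!: terms.intros)

lemma subst_terms:
  assumes "t \<in> terms ar X" "\<And>x. x \<in> X \<Longrightarrow> \<sigma> x \<in> terms ar Y"
  shows "subst \<sigma> t \<in> terms ar Y"
  using assms by (induction t) (auto intro!: terms.intros)

lemma map_subst:
  assumes "t \<in> terms ar X" "\<And>x. x \<in> X \<Longrightarrow> \<tau> x = map_trm h (\<sigma> x)"
  shows "map_trm h (subst \<sigma> t) = subst \<tau> t"
  using assms by (induction t) auto

lemma terms_vars:
  assumes "t \<in> terms ar X" shows "vars t \<subseteq> X"
  using assms by induction auto

lemma map_trm_cong_terms:
  assumes "t \<in> terms ar X" "\<And>x. x \<in> X \<Longrightarrow> h x = h' x"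
  shows "map_trm h t = map_trm h' t"
  using terms_vars[OF assms(1)] assms(2) by (auto intro!: trm.map_cong)

lemma inst_terms:
  assumes "wf_rule ar r" "length ss = length (targets r)" "set ss \<subseteq> terms ar X"
  shows "inst r ss \<in> terms ar X"
  unfolding inst_def
proof (rule subst_terms)
  show "body r \<in> terms ar (set (targets r))"
    using assms(1) by (simp add: wf_rule_def)
  fix y assume "y \<in> set (targets r)"
  \<comment> \<open>Equal lengths give every target variable an entry, so \<open>the\<close> is
    never applied to \<open>None\<close> on the variables of the body.\<close>
  then obtain s where "map_of (zip (targets r) ss) y = Some s"
    using assms(2) by (metis map_of_zip_is_Some)
  then show "the (map_of (zip (targets r) ss) y) \<in> terms ar X"
    using assms(3) by (auto dest!: map_of_SomeD set_zip_rightD)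
qed

text \<open>A rule body has only target variables, and all of them are replaced; a renaming
  therefore reaches only the leaves of the substituted terms.\<close>

lemma map_inst:
  assumes "wf_rule ar r" "length ss = length (targets r)"
  shows "map_trm h (inst r ss) = inst r (map (map_trm h) ss)"
  unfolding inst_def
proof (rule map_subst)
  show "body r \<in> terms ar (set (targets r))"
    using assms(1) by (simp add: wf_rule_def)
  fix y assume "y \<in> set (targets r)"
  then obtain s where "map_of (zip (targets r) ss) y = Some s"
    using assms(2) by (metis map_of_zip_is_Some)
  then show "the (map_of (zip (targets r) (map (map_trm h) ss)) y) =
      map_trm h (the (map_of (zip (targets r) ss) y))"
    by (simp add: zip_map2 map_of_map)
qed

section \<open>The Mealy machine as a function, and its output stream\<close>

definition mealy :: "('f, 'a, 'y) rule set \<Rightarrow> ('x \<Rightarrow> 'a) \<Rightarrow> ('f, 'x) trm \<Rightarrow> 'a \<times> ('f, 'x) trm" where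
  "mealy R \<sigma> t = rho R (map_trm (\<lambda>x. (\<sigma> x, x)) t)"

lemma mealy_Var: "mealy R \<sigma> (Var x) = (\<sigma> x, Var x)"
  by (simp add: mealy_def)

lemma mealy_Op:
  "mealy R \<sigma> (Op f ts) =
     (let ps = map (mealy R \<sigma>) ts; r = the_rule R f (map fst ps)
      in (out r, inst r (map snd ps)))"
  by (simp add: mealy_def Let_def comp_def)

text \<open>Instead of indexing inputs by the position in a run, all input streams advance by one
  letter per transition. In this form coinduction and induction on prefixes apply directly.\<close>

primcorec unfold_sem ::
  "('f, 'a, 'y) rule set \<Rightarrow> ('f, 'x) trm \<Rightarrow> ('x \<Rightarrow> 'a stream) \<Rightarrow> 'a stream" where
  "shd (unfold_sem R t \<psi>) = fst (mealy R (shd \<circ> \<psi>) t)"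
| "stl (unfold_sem R t \<psi>) = unfold_sem R (snd (mealy R (shd \<circ> \<psi>) t)) (stl \<circ> \<psi>)"

section \<open>Determinacy of rules: naturality, runs and causality\<close>

context
  fixes ar :: "'f \<Rightarrow> nat" and R :: "('f, 'a, 'y) rule set"
  assumes gsos: "monadic_gsos ar R"
begin

lemma the_rule:
  assumes "length as = ar f"
  shows "the_rule R f as \<in> R" "rop (the_rule R f as) = f" "labels (the_rule R f as) = as"
    "wf_rule ar (the_rule R f as)" "length (targets (the_rule R f as)) = ar f"
proof -
  have "\<exists>!r. r \<in> R \<and> rop r = f \<and> labels r = as"
    using gsos assms by (auto simp: monadic_gsos_def)
  then have *: "the_rule R f as \<in> R \<and> rop (the_rule R f as) = f \<and> labels (the_rule R f as) = as"
    unfolding the_rule_def by (rule theI')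
  then show "the_rule R f as \<in> R" "rop (the_rule R f as) = f" "labels (the_rule R f as) = as"
    by auto
  show wf: "wf_rule ar (the_rule R f as)"
    using * gsos by (auto simp: monadic_gsos_def)
  show "length (targets (the_rule R f as)) = ar f"
    using wf * by (simp add: wf_rule_def)
qed

text \<open>Well-formedness gives the label list of \<open>r\<close> the length of the arity, so the
  exactly-one condition applies to \<open>r\<close> itself.\<close>

lemma the_rule_eq: "r \<in> R \<Longrightarrow> the_rule R (rop r) (labels r) = r"
  using gsos the_rule[of "labels r" "rop r"] unfolding monadic_gsos_def wf_rule_def by metis

lemma rho_terms:
  assumes "u \<in> terms ar (UNIV \<times> X)"
  shows "snd (rho R u) \<in> terms ar X"
  using assms
  by induction (auto simp: Let_def the_rule intro!: terms.intros inst_terms)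

text \<open>Renaming the second components leaves all labels unchanged, so the same rule is selected
  on both sides, and \<open>map_inst\<close> handles its conclusion.\<close>

lemma rho_natural:
  assumes "u \<in> terms ar X"
  shows "rho R (map_trm (map_prod id h) u) = map_prod id (map_trm h) (rho R u)"
  using assms
proof induction
  case (var x)
  then show ?case by (cases x) simp
next
  case (oper ts f)
  then have ps: "map (rho R) (map (map_trm (map_prod id h)) ts) =
      map (map_prod id (map_trm h)) (map (rho R) ts)"
    by (simp add: id_def)
  show ?case
    unfolding trm.map rho.simps Let_def ps
    using oper.hyps by (simp add: map_inst[of ar] the_rule comp_def)
qed

lemma mealy_terms:
  assumes "t \<in> terms ar X" shows "snd (mealy R \<sigma> t) \<in> terms ar X"
  unfolding mealy_def by (intro rho_terms map_trm_terms[OF assms]) auto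

lemma mealy_map:
  assumes "t \<in> terms ar X"
  shows "mealy R \<sigma> (map_trm h t) = map_prod id (map_trm h) (mealy R (\<sigma> \<circ> h) t)"
proof -
  have "map_trm (\<lambda>x. (\<sigma> x, x)) (map_trm h t) =
      map_trm (map_prod id h) (map_trm (\<lambda>x. ((\<sigma> \<circ> h) x, x)) t)"
    by (simp add: trm.map_comp comp_def)
  moreover have "map_trm (\<lambda>x. ((\<sigma> \<circ> h) x, x)) t \<in> terms ar UNIV"
    using assms by (rule map_trm_terms) simp
  ultimately show ?thesis
    by (simp add: mealy_def rho_natural)
qed

text \<open>The transition relation is the graph of a function: the outputs of the subterms
  determine the one applicable rule.\<close>

lemma step_iff_mealy:
  assumes "t \<in> terms ar X"
  shows "step R \<sigma> t a t' \<longleftrightarrow> mealy R \<sigma> t = (a, t')"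
  using assms
proof (induction arbitrary: a t')
  case (var x)
  then show ?case
    by (auto simp: mealy_Var intro: step.var elim: step.cases)
next
  case (oper ts f)
  have IH: "step R \<sigma> (ts ! i) b s \<longleftrightarrow> mealy R \<sigma> (ts ! i) = (b, s)" if "i < length ts" for i b s
    using oper.IH that by simp
  let ?as = "map (fst \<circ> mealy R \<sigma>) ts" and ?ss = "map (snd \<circ> mealy R \<sigma>) ts"
  have mealy: "mealy R \<sigma> (Op f ts) = (out (the_rule R f ?as), inst (the_rule R f ?as) ?ss)"
    by (simp add: mealy_Op Let_def)
  show ?case
  proof
    assume "step R \<sigma> (Op f ts) a t'"
    then show "mealy R \<sigma> (Op f ts) = (a, t')"
    proof cases
      case (oper r ts')
      \<comment> \<open>By induction the premises carry exactly the labels and successors that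
        \<open>mealy\<close> computes, so \<open>the_rule_eq\<close> identifies \<open>r\<close>
        with the selected rule.\<close>
      then have "?as = labels r" "?ss = ts'"
        using IH by (auto intro!: nth_equalityI)
      then show ?thesis
        using oper mealy the_rule_eq by simp
    qed
  next
    assume "mealy R \<sigma> (Op f ts) = (a, t')"
    moreover have "step R \<sigma> (Op (rop (the_rule R f ?as)) ts)
        (out (the_rule R f ?as)) (inst (the_rule R f ?as) ?ss)"
      using oper.hyps by (intro step.oper) (auto simp: the_rule IH)
    ultimately show "step R \<sigma> (Op f ts) a t'"
      using mealy oper.hyps by (simp add: the_rule)
  qed
qed

lemma open_run_unfold:
  assumes "t \<in> terms ar X" "open_run R t \<psi> s"
  shows "shd s = fst (mealy R (shd \<circ> \<psi>) t)"
    and "open_run R (snd (mealy R (shd \<circ> \<psi>) t)) (stl \<circ> \<psi>) (stl s)"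
proof -
  obtain ts where ts: "ts 0 = t" "\<And>k. step R (\<lambda>x. \<psi> x !! k) (ts k) (s !! k) (ts (Suc k))"
    using assms(2) by (auto simp: open_run_def)
  have 1: "mealy R (shd \<circ> \<psi>) t = (shd s, ts 1)"
    using ts(1) ts(2)[of 0] step_iff_mealy[OF assms(1)] by (simp add: comp_def)
  then show "shd s = fst (mealy R (shd \<circ> \<psi>) t)"
    by simp
  show "open_run R (snd (mealy R (shd \<circ> \<psi>) t)) (stl \<circ> \<psi>) (stl s)"
    \<comment> \<open>The same run shifted by one; state and input indices move together.\<close>
    unfolding open_run_def
    using 1 ts(2)[of "Suc _"] by (intro exI[of _ "\<lambda>k. ts (Suc k)"]) simp
qed

lemma open_run_unfold_sem:
  assumes "t \<in> terms ar X"
  shows "open_run R t \<psi> (unfold_sem R t \<psi>)"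
proof -
  \<comment> \<open>The states visited when \<open>mealy\<close> is iterated, reading letter
    \<open>k\<close> of every input in transition \<open>k\<close>.\<close>
  define ts where "ts = rec_nat t (\<lambda>k. snd \<circ> mealy R (\<lambda>x. \<psi> x !! k))"
  have ts_Suc: "ts (Suc k) = snd (mealy R (\<lambda>x. \<psi> x !! k) (ts k))" for k
    by (simp add: ts_def)
  have terms: "ts k \<in> terms ar X" for k
    by (induction k) (simp_all add: ts_def assms mealy_terms)
  \<comment> \<open>Dropping \<open>k\<close> outputs amounts to restarting in the
    \<open>k\<close>-th state with inputs advanced by \<open>k\<close>; heads of both sides then
    give the \<open>k\<close>-th output.\<close>
  have sdrop: "sdrop k (unfold_sem R t \<psi>) = unfold_sem R (ts k) (sdrop k \<circ> \<psi>)" for k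
  proof (induction k)
    case 0
    show ?case by (simp add: ts_def comp_def)
  next
    case (Suc k)
    have "sdrop (Suc k) (unfold_sem R t \<psi>) = stl (unfold_sem R (ts k) (sdrop k \<circ> \<psi>))"
      by (simp only: sdrop_simps(2)[symmetric] Suc.IH)
    then show ?case
      by (simp add: ts_Suc comp_def)
  qed
  have "step R (\<lambda>x. \<psi> x !! k) (ts k) (unfold_sem R t \<psi> !! k) (ts (Suc k))" for k
    by (subst step_iff_mealy[OF terms], subst sdrop_simps(1)[symmetric])
      (simp add: sdrop ts_Suc comp_def)
  then show ?thesis
    unfolding open_run_def by (intro exI[of _ ts]) (simp add: ts_def)
qed

text \<open>\<open>open_run_unfold_sem\<close> supplies a run; any other has the same output by
  coinduction, as \<open>open_run_unfold\<close> forces its head and makes its tail the output of a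
  run again.\<close>

lemma open_sem_eq_unfold_sem:
  assumes "t \<in> terms ar X"
  shows "open_sem R t \<psi> = unfold_sem R t \<psi>"
  unfolding open_sem_def
proof (rule the_equality)
  show "open_run R t \<psi> (unfold_sem R t \<psi>)"
    using assms by (rule open_run_unfold_sem)
  fix s assume "open_run R t \<psi> s"
  with assms show "s = unfold_sem R t \<psi>"
  proof (coinduction arbitrary: t \<psi> s rule: stream.coinduct_strong)
    case Eq_stream
    then show ?case
      using open_run_unfold[of t X \<psi> s] mealy_terms[of t X "shd \<circ> \<psi>"] by auto
  qed
qed

text \<open>By \<open>mealy_map\<close> a renaming passes through one transition unchanged, so pairs
  of this shape form a bisimulation.\<close>

lemma unfold_sem_map:
  assumes "t \<in> terms ar X"
  shows "unfold_sem R (map_trm h t) \<psi> = unfold_sem R t (\<psi> \<circ> h)"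
  using assms
proof (coinduction arbitrary: t \<psi> rule: stream.coinduct_strong)
  case Eq_stream
  have "mealy R (shd \<circ> \<psi>) (map_trm h t) =
      map_prod id (map_trm h) (mealy R (shd \<circ> (\<psi> \<circ> h)) t)"
    by (simp add: mealy_map[OF Eq_stream] comp_assoc)
  then show ?case
    using mealy_terms[OF Eq_stream] by simp (metis comp_assoc)
qed

lemma mealy_cong:
  assumes "t \<in> terms ar X" "\<And>x. x \<in> X \<Longrightarrow> \<sigma> x = \<sigma>' x"
  shows "mealy R \<sigma> t = mealy R \<sigma>' t"
  unfolding mealy_def
  by (intro arg_cong[where f = "rho R"] map_trm_cong_terms[OF assms(1)]) (simp add: assms(2))

text \<open>The first output and the next state depend only on the heads of the inputs at
  \<open>X\<close>; the tails then need to agree on one letter fewer.\<close>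

lemma unfold_sem_causal:
  assumes "t \<in> terms ar X"
  shows "unfold_sem R t \<in> causal X"
proof -
  have "stake n (unfold_sem R t \<psi>) = stake n (unfold_sem R t \<psi>')"
    if "\<forall>x\<in>X. stake n (\<psi> x) = stake n (\<psi>' x)" for n \<psi> \<psi>'
    using assms that
  proof (induction n arbitrary: t \<psi> \<psi>')
    case (Suc n)
    have "mealy R (shd \<circ> \<psi>) t = mealy R (shd \<circ> \<psi>') t"
      using Suc.prems by (intro mealy_cong) auto
    then show ?case
      using Suc.prems by (auto intro!: Suc.IH mealy_terms)
  qed simp
  then show ?thesis
    by (auto simp: causal_def)
qed

end

section \<open>Causal functions, the term functor and the companion functor\<close>

lemma causalD:
  assumes "c \<in> causal X" "\<And>x. x \<in> X \<Longrightarrow> stake n (\<psi> x) = stake n (\<psi>' x)"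
  shows "stake n (c \<psi>) = stake n (c \<psi>')"
  using assms unfolding causal_def by blast

lemma causal_cong:
  assumes "c \<in> causal X" "\<And>x. x \<in> X \<Longrightarrow> \<psi> x = \<psi>' x"
  shows "c \<psi> = c \<psi>'"
proof -
  have stake: "stake n (c \<psi>) = stake n (c \<psi>')" for n
    using assms(1) by (rule causalD) (simp add: assms(2))
  have "c \<psi> !! n = c \<psi>' !! n" for n
    using arg_cong[OF stake[of "Suc n"], of "\<lambda>xs. xs ! n"] by (simp only: stake_nth lessI)
  \<comment> \<open>With \<open>id\<close> for the mapped function, \<open>smap_alt\<close> is
    extensionality of streams.\<close>
  then show ?thesis
    by (simp add: smap_alt[of id, simplified stream.map_id, THEN iffD2])
qed

text \<open>The case of prefixes of length one. It makes the output of the companion independent of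
  the choice of \<open>\<alpha>\<close>.\<close>

lemma causal_shd_cong:
  assumes "c \<in> causal X" "\<And>x. x \<in> X \<Longrightarrow> shd (\<psi> x) = shd (\<psi>' x)"
  shows "shd (c \<psi>) = shd (c \<psi>')"
proof -
  have "stake (Suc 0) (c \<psi>) = stake (Suc 0) (c \<psi>')"
    using assms(1) by (rule causalD) (simp add: assms(2))
  then show ?thesis by simp
qed

lemma term_functor_is_functor: "is_functor U (term_functor ar)"
  unfolding is_functor_def term_functor_def set_functor.sel
  by (auto simp: trm.map_comp trm.map_id comp_def intro: map_trm_terms map_trm_cong_terms)

lemma causal_precomp:
  assumes "c \<in> causal X" "h \<in> X \<rightarrow> Y"
  shows "(\<lambda>\<phi>. c (\<phi> \<circ> h)) \<in> causal Y"
  using assms unfolding causal_def by (auto simp: Pi_iff)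

lemma companion_functor_is_functor: "is_functor U companion_functor"
  unfolding is_functor_def companion_functor_def set_functor.sel
proof (intro conjI ballI impI funcsetI, goal_cases)
  case (1 X Y h c)
  then show ?case by (intro causal_precomp)
next
  case (2 X Y h h' c)
  \<comment> \<open>Two representatives of one map agree only on \<open>X\<close>, but a causal
    function over \<open>X\<close> cannot see the difference elsewhere.\<close>
  show ?case
  proof
    fix \<phi>
    show "c (\<phi> \<circ> h) = c (\<phi> \<circ> h')"
      using \<open>c \<in> causal X\<close> by (rule causal_cong) (simp add: 2)
  qed
qed (simp_all add: comp_assoc)

section \<open>The companion as a distributive law\<close>

context
  fixes U :: "'u set set" and pair :: "'a \<times> 'u \<Rightarrow> 'u"
  assumes univ: "set_universe U pair"
begin

lemma inv_pair [simp]: "inv pair (pair p) = p"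
  using univ by (simp add: set_universe_def)

lemma F_obj_in_universe: "X \<in> U \<Longrightarrow> F_obj pair X \<in> U"
  using univ by (simp add: set_universe_def)

lemma inv_pair_F_obj: "inv pair \<in> F_obj pair X \<rightarrow> UNIV \<times> X"
  by (auto simp: F_obj_def)

lemma F_arr_F_obj: "h \<in> X \<rightarrow> Y \<Longrightarrow> F_arr pair h \<in> F_obj pair X \<rightarrow> F_obj pair Y"
  by (auto simp: F_obj_def F_arr_def)

text \<open>Prefixing turns agreement on \<open>n\<close> letters into agreement on
  \<open>Suc n\<close>; taking the tail of the output loses the extra letter again.\<close>

lemma causal_stl_prefixed:
  fixes c :: "('u \<Rightarrow> 'a stream) \<Rightarrow> 'a stream"
  assumes "c \<in> causal (F_obj pair X)"
  shows "(\<lambda>\<psi>. stl (c (\<lambda>p. case inv pair p of (a, x) \<Rightarrow> a ## \<psi> x))) \<in> causal X"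
  unfolding causal_def
proof (intro CollectI allI impI)
  fix n and \<psi> \<psi>' :: "'u \<Rightarrow> 'a stream"
  assume "\<forall>x\<in>X. stake n (\<psi> x) = stake n (\<psi>' x)"
  then have "stake (Suc n) (c (\<lambda>p. case inv pair p of (a, x) \<Rightarrow> a ## \<psi> x)) =
      stake (Suc n) (c (\<lambda>p. case inv pair p of (a, x) \<Rightarrow> a ## \<psi>' x))"
    by (intro causalD[OF assms]) (auto simp: F_obj_def)
  then show "stake n (stl (c (\<lambda>p. case inv pair p of (a, x) \<Rightarrow> a ## \<psi> x))) =
      stake n (stl (c (\<lambda>p. case inv pair p of (a, x) \<Rightarrow> a ## \<psi>' x)))"
    by simp
qed

lemma companion_dl_object: "dl_object U pair (companion U pair \<alpha>)"
proof -
  \<comment> \<open>\<open>F_arr pair h\<close> keeps the letter and applies \<open>h\<close> to the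
    element, so precomposition with it only changes what follows the prefixed letter.\<close>
  have F_arr: "(\<lambda>p. case inv pair p of (a, x) \<Rightarrow> g a x) \<circ> F_arr pair h =
      (\<lambda>p. case inv pair p of (a, x) \<Rightarrow> g a (h x))" for g :: "'a \<Rightarrow> 'u \<Rightarrow> 'a stream" and h
    by (auto simp: F_arr_def fun_eq_iff split: prod.split)
  have "nat_trans U (after_F pair companion_functor) (then_F companion_functor)
      (snd (companion U pair \<alpha>))"
    unfolding nat_trans_def companion_def after_F_def then_F_def companion_functor_def
      snd_conv set_functor.sel
  proof (intro conjI ballI, goal_cases)
    case 1
    show ?case
      by (intro restrict_PiE_iff[THEN iffD2] ballI SigmaI UNIV_I causal_stl_prefixed)
  next
    case (2 X Y h c)
    then have "(\<lambda>\<phi>. c (\<phi> \<circ> F_arr pair h)) \<in> causal (F_obj pair Y)"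
      using causal_precomp[OF _ F_arr_F_obj[of h X Y]] by blast
    with 2 show ?case by (simp add: F_arr)
  qed
  then show ?thesis
    using companion_functor_is_functor by (simp add: dl_object_def companion_def)
qed

section \<open>The term law and its morphism into the companion\<close>

context
  fixes ar :: "'f \<Rightarrow> nat" and R :: "('f, 'a, 'y) rule set"
  assumes gsos: "monadic_gsos ar R"
begin

lemma rho_inv_pair_terms:
  assumes "u \<in> terms ar (F_obj pair X)"
  shows "snd (rho R (map_trm (inv pair) u)) \<in> terms ar X"
  using assms by (intro rho_terms[OF gsos] map_trm_terms[OF _ inv_pair_F_obj])

lemma term_law_dl_object: "dl_object U pair (term_law U pair ar R)"
proof -
  \<comment> \<open>Decoding with \<open>inv pair\<close> turns \<open>F_arr pair h\<close> into
    \<open>map_prod id h\<close>, which reduces the claim to \<open>rho_natural\<close>.\<close>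
  have natural: "rho R (map_trm (inv pair) (map_trm (F_arr pair h) u)) =
      map_prod id (map_trm h) (rho R (map_trm (inv pair) u))"
    if "u \<in> terms ar (F_obj pair X)" for u X h
  proof -
    have "map_trm (inv pair) (map_trm (F_arr pair h) u) =
        map_trm (map_prod id h) (map_trm (inv pair) u)"
      by (simp add: trm.map_comp comp_def F_arr_def)
    then show ?thesis
      using rho_natural[OF gsos map_trm_terms[OF that inv_pair_F_obj]] by simp
  qed
  have "nat_trans U (after_F pair (term_functor ar)) (then_F (term_functor ar))
      (snd (term_law U pair ar R))"
    unfolding nat_trans_def term_law_def after_F_def then_F_def term_functor_def
      snd_conv set_functor.sel
  proof (intro conjI ballI, goal_cases)
    case 1
    show ?case
      using rho_inv_pair_terms by (auto simp: mem_Times_iff)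
  next
    case (2 X Y h u)
    then have "map_trm (F_arr pair h) u \<in> terms ar (F_obj pair Y)"
      using map_trm_terms[OF _ F_arr_F_obj[of h X Y]] by blast
    with 2 show ?case by (simp add: natural)
  qed
  then show ?thesis
    using term_functor_is_functor by (simp add: dl_object_def term_law_def)
qed

text \<open>The first input letter at each leaf is the letter stored there, so the machine on
  \<open>u\<close> selects the same rules as \<rho>. Its successor still has leaves in
  \<open>F_obj pair X\<close>; renaming by \<open>snd \<circ> inv pair\<close> removes the letters,
  and \<open>unfold_sem_map\<close> absorbs this renaming.\<close>

lemma unfold_sem_prefixed:
  assumes "u \<in> terms ar (F_obj pair X)"
  shows "shd (unfold_sem R u (\<lambda>p. case inv pair p of (a, x) \<Rightarrow> a ## \<psi> x)) =
      fst (rho R (map_trm (inv pair) u))"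
    and "stl (unfold_sem R u (\<lambda>p. case inv pair p of (a, x) \<Rightarrow> a ## \<psi> x)) =
      unfold_sem R (snd (rho R (map_trm (inv pair) u))) \<psi>"
proof -
  let ?\<psi> = "\<lambda>p. case inv pair p of (a, x) \<Rightarrow> a ## \<psi> x"
  let ?m = "mealy R (shd \<circ> ?\<psi>) u"
  have shd: "shd \<circ> ?\<psi> = fst \<circ> inv pair" and stl: "stl \<circ> ?\<psi> = \<psi> \<circ> (snd \<circ> inv pair)"
    by (auto simp: fun_eq_iff split: prod.split)
  have "map_trm (inv pair) u =
      map_trm (map_prod id (snd \<circ> inv pair)) (map_trm (\<lambda>p. ((shd \<circ> ?\<psi>) p, p)) u)"
    unfolding shd by (simp add: trm.map_comp comp_def)
  moreover have "map_trm (\<lambda>p. ((shd \<circ> ?\<psi>) p, p)) u \<in> terms ar UNIV"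
    using assms by (rule map_trm_terms) simp
  ultimately have rho: "rho R (map_trm (inv pair) u) = map_prod id (map_trm (snd \<circ> inv pair)) ?m"
    by (simp only: rho_natural[OF gsos] mealy_def)
  show "shd (unfold_sem R u ?\<psi>) = fst (rho R (map_trm (inv pair) u))"
    by (simp add: rho)
  show "stl (unfold_sem R u ?\<psi>) = unfold_sem R (snd (rho R (map_trm (inv pair) u))) \<psi>"
    by (simp add: rho stl unfold_sem_map[OF gsos mealy_terms[OF gsos assms]] del: o_apply)
qed

lemma unfold_sem_dl_morphism:
  "dl_morphism U pair (term_law U pair ar R) (companion U pair \<alpha>)
     (\<lambda>X\<in>U. \<lambda>t\<in>terms ar X. unfold_sem R t)"
  (is "dl_morphism U pair _ _ ?\<theta>")
proof -
  have "nat_trans U (term_functor ar) companion_functor ?\<theta>"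
    unfolding nat_trans_def term_functor_def companion_functor_def set_functor.sel
  proof (intro conjI ballI, goal_cases)
    case 1
    show ?case
      using unfold_sem_causal[OF gsos] by auto
  next
    case (2 X Y h t)
    then have "map_trm h t \<in> terms ar Y"
      using map_trm_terms by blast
    with 2 show ?case
      by (simp add: fun_eq_iff unfold_sem_map[OF gsos])
  qed
  moreover have "snd (companion U pair \<alpha>) X (?\<theta> (F_obj pair X) u) =
      map_prod id (?\<theta> X) (snd (term_law U pair ar R) X u)"
    if "X \<in> U" "u \<in> terms ar (F_obj pair X)" for X u
    \<comment> \<open>The output component is evaluated at \<open>a ## \<alpha>\<close>, hence the
      extra instance at the constant assignment; \<open>unfold_sem.sel\<close> is removed so that
      heads and tails are rewritten by \<open>unfold_sem_prefixed\<close>.\<close>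
    using that unfold_sem_causal[OF gsos that(2)] rho_inv_pair_terms[OF that(2)]
    by (simp add: companion_def term_law_def F_obj_in_universe unfold_sem_prefixed[OF that(2)]
        prod_eq_iff fun_eq_iff unfold_sem_prefixed(1)[OF that(2), of "\<lambda>_. \<alpha>"] del: unfold_sem.sel)
  ultimately show ?thesis
    unfolding dl_morphism_def
    using companion_dl_object term_law_dl_object
    by (simp add: companion_def term_law_def term_functor_def)
qed

section \<open>Uniqueness of the morphism and agreement with the open semantics\<close>

lemma dl_morphism_eq_unfold_sem:
  assumes mor: "dl_morphism U pair (term_law U pair ar R) (companion U pair \<alpha>) \<kappa>"
    and "V \<in> U" "t \<in> terms ar V"
  shows "\<kappa> V t \<psi> = unfold_sem R t \<psi>"
  using \<open>t \<in> terms ar V\<close>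
proof (coinduction arbitrary: t \<psi> rule: stream.coinduct_strong)
  case Eq_stream
  \<comment> \<open>Each variable is paired with its first input letter, so that prefixing the tails
    of \<psi> and precomposing with \<open>h\<close> gives back \<psi>.\<close>
  define h where "h = (\<lambda>x. pair (shd (\<psi> x), x))"
  let ?FV = "F_obj pair V" and ?u = "map_trm h t"
  let ?pre = "\<lambda>\<phi> p. case inv pair p of (a, x) \<Rightarrow> a ## \<phi> x"
  have h: "h \<in> V \<rightarrow> ?FV"
    by (auto simp: h_def F_obj_def)
  have u: "?u \<in> terms ar ?FV"
    using Eq_stream h by (rule map_trm_terms)
  have nat: "nat_trans U (term_functor ar) companion_functor \<kappa>"
    using mor by (simp add: dl_morphism_def term_law_def companion_def)
  have causal: "\<kappa> ?FV ?u \<in> causal ?FV"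
    using nat u F_obj_in_universe[OF \<open>V \<in> U\<close>]
    by (auto simp: nat_trans_def term_functor_def companion_functor_def)
  have "\<kappa> ?FV ?u = (\<lambda>\<phi>. \<kappa> V t (\<phi> \<circ> h))"
    using nat h Eq_stream \<open>V \<in> U\<close> F_obj_in_universe[OF \<open>V \<in> U\<close>]
    by (simp add: nat_trans_def term_functor_def companion_functor_def)
  moreover have "?pre (stl \<circ> \<psi>) \<circ> h = \<psi>"
    by (auto simp: h_def)
  ultimately have factor: "\<kappa> V t \<psi> = \<kappa> ?FV ?u (?pre (stl \<circ> \<psi>))"
    by simp
  \<comment> \<open>Labelling the leaves by \<open>h\<close> and then applying \<rho> is one
    transition under the first input letters.\<close>
  have rho: "rho R (map_trm (inv pair) ?u) = mealy R (shd \<circ> \<psi>) t"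
    by (simp add: mealy_def h_def trm.map_comp comp_def)
  have mor_eq: "(shd (\<kappa> ?FV ?u (?pre (\<lambda>_. \<alpha>))), \<lambda>\<phi>. stl (\<kappa> ?FV ?u (?pre \<phi>))) =
      map_prod id (\<kappa> V) (mealy R (shd \<circ> \<psi>) t)"
  proof -
    have "snd (companion U pair \<alpha>) V (\<kappa> ?FV ?u) =
        map_prod id (\<kappa> V) (snd (term_law U pair ar R) V ?u)"
      using mor u \<open>V \<in> U\<close> by (simp add: dl_morphism_def term_law_def term_functor_def)
    then show ?thesis
      using u causal \<open>V \<in> U\<close> by (simp add: companion_def term_law_def flip: rho)
  qed
  \<comment> \<open>The two assignments differ only behind the prefixed letter, which a causal
    function ignores for its first output.\<close>
  have "shd (\<kappa> V t \<psi>) = shd (\<kappa> ?FV ?u (?pre (\<lambda>_. \<alpha>)))"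
    unfolding factor by (rule causal_shd_cong[OF causal]) (auto split: prod.split)
  \<comment> \<open>The second component of \<open>mor_eq\<close> is an equation between functions,
    taken at \<open>stl \<circ> \<psi>\<close>.\<close>
  moreover have "stl (\<kappa> V t \<psi>) = \<kappa> V (snd (mealy R (shd \<circ> \<psi>) t)) (stl \<circ> \<psi>)"
    using mor_eq by (auto simp: factor prod_eq_iff dest: fun_cong[of _ _ "stl \<circ> \<psi>"])
  ultimately show ?case
    using mor_eq mealy_terms[OF gsos Eq_stream] by (auto simp: prod_eq_iff)
qed

text \<open>\<open>nat_trans\<close> requires extensional families, so agreement on the objects in
  \<open>U\<close> and on their terms is equality of HOL functions.\<close>

lemma dl_morphism_unique:
  assumes mor: "dl_morphism U pair (term_law U pair ar R) (companion U pair \<alpha>) \<kappa>"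
  shows "\<kappa> = (\<lambda>X\<in>U. \<lambda>t\<in>terms ar X. unfold_sem R t)"
proof -
  have \<kappa>: "\<kappa> \<in> (\<Pi>\<^sub>E X\<in>U. terms ar X \<rightarrow>\<^sub>E causal X)"
    using mor by (simp add: dl_morphism_def nat_trans_def term_law_def companion_def
        term_functor_def companion_functor_def)
  have "\<kappa> X = (\<lambda>t\<in>terms ar X. unfold_sem R t)" if "X \<in> U" for X
    using \<kappa> that dl_morphism_eq_unfold_sem[OF mor that]
    by (intro extensionalityI[of _ "terms ar X"]) (auto simp: PiE_iff)
  then show ?thesis
    using \<kappa> by (intro extensionalityI[of _ U]) (auto simp: PiE_iff)
qed

end

end

theorem theorem8:
  fixes ar :: "'f \<Rightarrow> nat"
    and R :: "('f, 'a, 'y) rule set"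
    and U :: "'u set set"
    and pair :: "'a \<times> 'u \<Rightarrow> 'u"
    and \<alpha> :: "'a stream"
  assumes "monadic_gsos ar R"
    and "set_universe U pair"
  shows "(\<exists>!\<kappa>. dl_morphism U pair (term_law U pair ar R) (companion U pair \<alpha>) \<kappa>) \<and>
    (\<forall>\<kappa>. dl_morphism U pair (term_law U pair ar R) (companion U pair \<alpha>) \<kappa> \<longrightarrow>
      (\<forall>\<V>\<in>U. \<forall>t\<in>terms ar \<V>. \<forall>\<psi>. \<kappa> \<V> t \<psi> = open_sem R t \<psi>))"
proof (intro conjI allI impI ballI)
  show "\<exists>!\<kappa>. dl_morphism U pair (term_law U pair ar R) (companion U pair \<alpha>) \<kappa>"
    using unfold_sem_dl_morphism[OF assms(2,1)] dl_morphism_unique[OF assms(2,1)] by blast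
next
  fix \<kappa> \<V> t \<psi>
  assume "dl_morphism U pair (term_law U pair ar R) (companion U pair \<alpha>) \<kappa>"
    and "\<V> \<in> U" "t \<in> terms ar \<V>"
  then show "\<kappa> \<V> t \<psi> = open_sem R t \<psi>"
    using dl_morphism_eq_unfold_sem[OF assms(2,1)] open_sem_eq_unfold_sem[OF assms(1)] by metis
qed

end
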